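(* The structure $(\mathbb{R},+,\cdot,<)$ of real numbers, constructed from infinite decimals as described in the context, is a complete ordered field (complete meaning that every nonempty subset of $\mathbb{R}$ bounded from above has a least upper bound).
   Context: Here $\mathbb{N}=\{1,2,\dots\}$, and the ordered ring $\mathbb{Z}$ of integers is taken as given; $\mathbb{R}$ denotes the set constructed below. Decimals. A signed decimal $d$ is a pair of a sign $+$ or $-$ and an infinite string of digits $d=\pm a_ka_{k-1}a_{k-2}\dots$ indexed by the integers $k,k-1,k-2,\dots$, where $k\in\mathbb{Z}$, $a_i\in\{0,1,\dots,9\}\subset\mathbb{Z}$ and $a_k\neq 0$. The zero decimal $0$ has no sign and only zero digits. $\mathbb{D}$ is the set of all decimals (signed and zero). A decimal with sign $+$ is positive, with sign $-$ negative. $d_i$ denotes the $i$th digit $a_i$ of $d$, with $d_i=0$ if $a_i$ does not exist. Two decimals are equal iff they have equal signs and $d_i=e_i$ for all $i\in\mathbb{Z}$, or both are zero. $-d$ is $d$ with the opposite sign, and $-0=0$. The usual decimal point notation is used ($+$ sign and trailing zeros omitted). Order on $\mathbb{D}$. For $d\ne e$ put $d<e$ iff one of the following holds: $d$ and $e$ both have sign $+$ (respectively both have sign $-$) and there is $m\in\mathbb{Z}$ with $d_i=e_i$ for $i>m$ and $d_m<e_m$ (respectively $d_m>e_m$); or $d$ has sign $-$ and $e$ is $0$ or has sign $+$; or $d=0$ and $e$ has sign $+$. This is a linear order. Real numbers. A jump is a pair $d<e$ in $\mathbb{D}$ with no decimal $f$ such that $d<f<e$ (for example $0.999\dots<1$).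 Write $d\sim e$ iff $d=e$, or $d<e$ is a jump, or $e<d$ is a jump; this is an equivalence relation. Set $\mathbb{R}=\mathbb{D}/\!\sim$, and let $[d]$ be the equivalence class of $d$. For $\alpha,\beta\in\mathbb{R}$ set $\alpha<\beta$ iff $\alpha\ne\beta$ and $d<e$ for some $d\in\alpha$, $e\in\beta$. Terminating decimals. $\mathbb{T}_0$ is the set of decimals with only finitely many nonzero digits (including $0$), and $\mathbb{Z}_0$ is the set of decimals $d$ with $d_i=0$ for all $i<0$. Decadic notation $0\mapsto 0$, $\pm a_k\dots a_0000\dots\mapsto\pm(a_k10^k+\dots+a_010^0)$ is a bijection $\mathbb{Z}_0\to\mathbb{Z}$, and $+,\cdot$ on $\mathbb{Z}_0$ are transferred from $\mathbb{Z}$ by it. For $d\in\mathbb{D}$ and $k\in\mathbb{Z}$, $10^kd$ is the decimal with the same sign as $d$ and $(10^kd)_i=d_{i-k}$. For $c,d\in\mathbb{T}_0$ define $c+d=10^{-k}(10^kc+10^kd)$ and $c\cdot d=10^{-2k}(10^kc\cdot 10^kd)$, where $k$ is any integer with $10^kc,10^kd\in\mathbb{Z}_0$ (the results do not depend on $k$); $c-d=c+(-d)$. Hybrid limits. For $n\in\mathbb{N}$ and $d\in\mathbb{D}$ the truncation $d|n\in\mathbb{T}_0$ has the same sign as $d$ and $(d|n)_i=d_i$ for $i\ge -n$, $(d|n)_i=0$ for $i<-n$; if all its digits are zero, $d|n$ is the zero decimal. For terminating decimals $c(n)$, $n=1,2,\dots$, write $c(n)\to 0$ if for every $k\in\mathbb{N}$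 there is $N\in\mathbb{N}$ with $c(n)|k=0$ for all $n>N$. A decimal $c$ is a hybrid limit of the sequence $c(n)$ if $c(n)-c|n\to 0$. $\mathrm{hlim}_n\,c(n)$ denotes the set of all hybrid limits of $c(n)$; if nonempty it is a single equivalence class, i.e. an element of $\mathbb{R}$. Arithmetic on $\mathbb{R}$. For $\alpha,\beta\in\mathbb{R}$, $\alpha+\beta=\mathrm{hlim}_n\,(c|n+d|n)$ and $\alpha\beta=\mathrm{hlim}_n\,(c|n\cdot d|n)$, where $c\in\alpha$ and $d\in\beta$ are arbitrary decimals (the results do not depend on the choice of $c,d$). *)

theory Defs
  imports "HOL-Algebra.Ring"
begin

section \<open>Complete ordered fields\<close>

locale ordered_field = field F for F (structure) +
  fixes lt :: "'a \<Rightarrow> 'a \<Rightarrow> bool" (infix "\<prec>" 50)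
  assumes lt_irrefl: "a \<in> carrier F \<Longrightarrow> \<not> a \<prec> a"
    and lt_trans: "\<lbrakk>a \<in> carrier F; b \<in> carrier F; c \<in> carrier F; a \<prec> b; b \<prec> c\<rbrakk> \<Longrightarrow> a \<prec> c"
    and lt_total: "\<lbrakk>a \<in> carrier F; b \<in> carrier F\<rbrakk> \<Longrightarrow> a \<prec> b \<or> a = b \<or> b \<prec> a"
    and lt_add: "\<lbrakk>a \<in> carrier F; b \<in> carrier F; c \<in> carrier F; a \<prec> b\<rbrakk> \<Longrightarrow> a \<oplus> c \<prec> b \<oplus> c"
    and lt_mult: "\<lbrakk>a \<in> carrier F; b \<in> carrier F; \<zero> \<prec> a; \<zero> \<prec> b\<rbrakk> \<Longrightarrow> \<zero> \<prec> a \<otimes> b"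
begin

abbreviation le :: "'a \<Rightarrow> 'a \<Rightarrow> bool" (infix "\<preceq>" 50)
  where "a \<preceq> b \<equiv> a \<prec> b \<or> a = b"

definition is_upper_bound :: "'a set \<Rightarrow> 'a \<Rightarrow> bool"
  where "is_upper_bound A u \<longleftrightarrow> u \<in> carrier F \<and> (\<forall>a\<in>A. a \<preceq> u)"

definition is_least_upper_bound :: "'a set \<Rightarrow> 'a \<Rightarrow> bool"
  where "is_least_upper_bound A s \<longleftrightarrow>
    is_upper_bound A s \<and> (\<forall>u. is_upper_bound A u \<longrightarrow> s \<preceq> u)"

end

locale complete_ordered_field = ordered_field +
  assumes complete:
    "\<lbrakk>A \<subseteq> carrier F; A \<noteq> {}; \<exists>u. is_upper_bound A u\<rbrakk> \<Longrightarrow> \<exists>s. is_least_upper_bound A s"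


section \<open>Decimals\<close>

datatype sign = Plus | Minus

fun opposite :: "sign \<Rightarrow> sign" where
  "opposite Plus = Minus"
| "opposite Minus = Plus"

text \<open>
  A string of digits is extended by zeros to all integer positions. A nonzero extended string
  that vanishes far to the left has a unique leading position, so no leading index is stored.
  The sign is absent exactly for the zero decimal.
\<close>

typedef decimal =
  "{(s :: sign option, a :: int \<Rightarrow> int).
      (\<forall>i. a i \<in> {0..9}) \<and> (\<exists>k. \<forall>i>k. a i = 0) \<and> (s = None \<longleftrightarrow> (\<forall>i. a i = 0))}"
  by (rule exI[of _ "(None, \<lambda>_. 0)"]) simp

setup_lifting type_definition_decimal

lift_definition dsign :: "decimal \<Rightarrow> sign option" is fst .

lift_definition digit :: "decimal \<Rightarrow> int \<Rightarrow> int" is snd .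

lift_definition dzero :: decimal is "(None, \<lambda>_. 0)"
  by simp

lift_definition dunit :: decimal is "(Some Plus, \<lambda>i. if i = 0 then 1 else 0)"
  by (auto intro: exI[of _ 0])

lift_definition dminus :: "decimal \<Rightarrow> decimal"
  is "\<lambda>(s, a). (map_option opposite s, a)"
  by auto

definition dless :: "decimal \<Rightarrow> decimal \<Rightarrow> bool" where
  "dless d e \<longleftrightarrow>
     (dsign d = Some Plus \<and> dsign e = Some Plus \<and>
        (\<exists>m. (\<forall>i>m. digit d i = digit e i) \<and> digit d m < digit e m)) \<or>
     (dsign d = Some Minus \<and> dsign e = Some Minus \<and>
        (\<exists>m. (\<forall>i>m. digit d i = digit e i) \<and> digit d m > digit e m)) \<or>
     (dsign d = Some Minus \<and> (e = dzero \<or> dsign e = Some Plus)) \<or>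
     (d = dzero \<and> dsign e = Some Plus)"


section \<open>Real numbers as classes of decimals\<close>

definition jump :: "decimal \<Rightarrow> decimal \<Rightarrow> bool" where
  "jump d e \<longleftrightarrow> dless d e \<and> \<not> (\<exists>f. dless d f \<and> dless f e)"

definition deq :: "(decimal \<times> decimal) set" where
  "deq = {(d, e). d = e \<or> jump d e \<or> jump e d}"

definition dclass :: "decimal \<Rightarrow> decimal set" where
  "dclass d = deq `` {d}"

definition Reals_dec :: "decimal set set" where
  "Reals_dec = UNIV // deq"

definition rless :: "decimal set \<Rightarrow> decimal set \<Rightarrow> bool" where
  "rless \<alpha> \<beta> \<longleftrightarrow> \<alpha> \<noteq> \<beta> \<and> (\<exists>d\<in>\<alpha>. \<exists>e\<in>\<beta>. dless d e)"


section \<open>Arithmetic of terminating decimals\<close>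

definition T0 :: "decimal set" where
  "T0 = {d. finite {i. digit d i \<noteq> 0}}"

definition Z0 :: "decimal set" where
  "Z0 = {d. \<forall>i<0. digit d i = 0}"

text \<open>Decadic notation; meaningful on \<open>Z0\<close>, which it maps bijectively onto the integers.\<close>

definition decadic :: "decimal \<Rightarrow> int" where
  "decadic d =
     (case dsign d of None \<Rightarrow> 0 | Some Plus \<Rightarrow> 1 | Some Minus \<Rightarrow> - 1) *
     (\<Sum>i | 0 \<le> i \<and> digit d i \<noteq> 0. digit d i * 10 ^ nat i)"

definition Z0_add :: "decimal \<Rightarrow> decimal \<Rightarrow> decimal" where
  "Z0_add c d = the_inv_into Z0 decadic (decadic c + decadic d)"

definition Z0_mult :: "decimal \<Rightarrow> decimal \<Rightarrow> decimal" where
  "Z0_mult c d = the_inv_into Z0 decadic (decadic c * decadic d)"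

text \<open>\<open>shift k d\<close> is the decimal $10^k d$.\<close>

lift_definition shift :: "int \<Rightarrow> decimal \<Rightarrow> decimal"
  is "\<lambda>k (s, a). (s, \<lambda>i. a (i - k))"
proof (clarsimp, intro conjI)
  fix k m :: int and s :: "sign option" and a :: "int \<Rightarrow> int"
  assume s: "(s = None) = (\<forall>i. a i = 0)" and m: "\<forall>i>m. a i = 0"
  show "\<exists>j. \<forall>i>j. a (i - k) = 0"
    by (rule exI[of _ "m + k"]) (simp add: m)
  show "(\<forall>i. a i = 0) = (\<forall>i. a (i - k) = 0)"
    by (metis add_diff_cancel_right')
qed

text \<open>
  The results do not depend on the scaling exponent \<open>k\<close>: the description operator asks
  for the value common to all admissible exponents. In \<open>radd\<close> and \<open>rmult\<close> below it likewise asks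
  for the value common to all choices of representatives.
\<close>

definition dadd :: "decimal \<Rightarrow> decimal \<Rightarrow> decimal" where
  "dadd c d = (THE e. \<forall>k. shift k c \<in> Z0 \<and> shift k d \<in> Z0 \<longrightarrow>
                 e = shift (- k) (Z0_add (shift k c) (shift k d)))"

definition dmult :: "decimal \<Rightarrow> decimal \<Rightarrow> decimal" where
  "dmult c d = (THE e. \<forall>k. shift k c \<in> Z0 \<and> shift k d \<in> Z0 \<longrightarrow>
                  e = shift (- 2 * k) (Z0_mult (shift k c) (shift k d)))"

definition ddiff :: "decimal \<Rightarrow> decimal \<Rightarrow> decimal" where
  "ddiff c d = dadd c (dminus d)"


section \<open>Hybrid limits\<close>

lift_definition trunc :: "decimal \<Rightarrow> nat \<Rightarrow> decimal"
  is "\<lambda>(s, a) n. (if \<forall>i\<ge>- int n. a i = 0 then None else s,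
                  \<lambda>i. if i \<ge> - int n then a i else 0)"
  by (auto split: if_splits) blast

text \<open>Sequences are indexed by $1, 2, \dots$; their values at \<open>0\<close> are irrelevant.\<close>

definition tends_to_zero :: "(nat \<Rightarrow> decimal) \<Rightarrow> bool" where
  "tends_to_zero c \<longleftrightarrow> (\<forall>k\<ge>1. \<exists>N\<ge>1. \<forall>n>N. trunc (c n) k = dzero)"

definition hlim :: "(nat \<Rightarrow> decimal) \<Rightarrow> decimal set" where
  "hlim c = {d. tends_to_zero (\<lambda>n. ddiff (c n) (trunc d n))}"


section \<open>The structure of real numbers\<close>

definition radd :: "decimal set \<Rightarrow> decimal set \<Rightarrow> decimal set" where
  "radd \<alpha> \<beta> = (THE \<gamma>. \<forall>c\<in>\<alpha>. \<forall>d\<in>\<beta>. \<gamma> = hlim (\<lambda>n. dadd (trunc c n) (trunc d n)))"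

definition rmult :: "decimal set \<Rightarrow> decimal set \<Rightarrow> decimal set" where
  "rmult \<alpha> \<beta> = (THE \<gamma>. \<forall>c\<in>\<alpha>. \<forall>d\<in>\<beta>. \<gamma> = hlim (\<lambda>n. dmult (trunc c n) (trunc d n)))"

definition real_ring :: "decimal set ring" where
  "real_ring = \<lparr>carrier = Reals_dec, monoid.mult = rmult, one = dclass dunit,
                zero = dclass dzero, add = radd\<rparr>"

end

theory Submission
  imports Defs Complex_Main
begin

text \<open>
  Every decimal has a value in the library's field of real numbers. Jumps are exactly the pairs
  \<open>d < e\<close> of equal value, so the classes of decimals correspond bijectively to real numbers, and
  the order on decimals is monotone in the value. On terminating decimals the value is injective and
  compatible with the digitwise arithmetic, and a hybrid limit of terminating decimals is a decimal
  whose value is the ordinary limit. Hence sending a number to the class of decimals of that value is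
  an isomorphism from the real numbers onto the constructed structure.
\<close>

section \<open>The magnitude of a decimal\<close>

lemma digit_nonneg: "0 \<le> digit d i"
  by transfer (auto split: prod.splits)

lemma digit_le_9: "digit d i \<le> 9"
  by transfer (auto split: prod.splits)

lemma digit_eventually_0: "\<exists>k. \<forall>i>k. digit d i = 0"
  by transfer (auto split: prod.splits)

lemma dsign_None_iff: "dsign d = None \<longleftrightarrow> (\<forall>i. digit d i = 0)"
  by transfer (auto split: prod.splits)

lemma decimal_eqI: "dsign d = dsign e \<Longrightarrow> digit d = digit e \<Longrightarrow> d = e"
  by transfer (auto split: prod.splits)

lemma ex_decimal:
  assumes "\<And>i. 0 \<le> a i" "\<And>i. a i \<le> 9" "\<forall>i>k. a i = 0" "s = None \<longleftrightarrow> (\<forall>i. a i = 0)"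
  shows "\<exists>d. dsign d = s \<and> digit d = a"
  using assms by transfer auto

lemma dsign_dzero [simp]: "dsign dzero = None" and digit_dzero [simp]: "digit dzero i = 0"
  by (transfer, simp)+

lemma eq_dzero_iff: "d = dzero \<longleftrightarrow> (\<forall>i. digit d i = 0)"
  by (metis decimal_eqI dsign_None_iff dsign_dzero digit_dzero ext)

lemma dsign_dunit [simp]: "dsign dunit = Some Plus"
  and digit_dunit: "digit dunit i = (if i = 0 then 1 else 0)"
  by (transfer, simp)+

lemma dsign_dminus: "dsign (dminus d) = map_option opposite (dsign d)"
  and digit_dminus [simp]: "digit (dminus d) = digit d"
  by (transfer, auto)+

lemma dsign_shift [simp]: "dsign (shift k d) = dsign d"
  and digit_shift: "digit (shift k d) i = digit d (i - k)"
  by (transfer, auto)+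

lemma dsign_trunc: "dsign (trunc d n) = (if \<forall>i\<ge>- int n. digit d i = 0 then None else dsign d)"
  and digit_trunc: "digit (trunc d n) i = (if i \<ge> - int n then digit d i else 0)"
  by (transfer, auto)+

section \<open>Finite partial sums of the digit expansion\<close>

definition partial :: "decimal \<Rightarrow> int \<Rightarrow> real" where
  "partial d m = (\<Sum>i | m \<le> i \<and> digit d i \<noteq> 0. of_int (digit d i) * 10 powi i)"

text \<open>Digits vanish far to the left. Finiteness matters because a sum over an infinite set is
  0 by default.\<close>

lemma finite_digits: "finite {i. m \<le> i \<and> digit d i \<noteq> 0}"
proof -
  obtain k where "\<forall>i>k. digit d i = 0" using digit_eventually_0 by blast
  then have "{i. m \<le> i \<and> digit d i \<noteq> 0} \<subseteq> {m..k}" by force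
  then show ?thesis by (rule finite_subset) simp
qed

lemma partial_step: "partial d m = partial d (m + 1) + of_int (digit d m) * 10 powi m"
proof (cases "digit d m = 0")
  case True
  then have "{i. m \<le> i \<and> digit d i \<noteq> 0} = {i. m + 1 \<le> i \<and> digit d i \<noteq> 0}"
    by (auto simp: order_le_less)
  then show ?thesis using True by (simp add: partial_def)
next
  case False
  then have "{i. m \<le> i \<and> digit d i \<noteq> 0} = insert m {i. m + 1 \<le> i \<and> digit d i \<noteq> 0}"
    by (auto simp: order_le_less)
  then show ?thesis using finite_digits[of "m + 1" d] by (simp add: partial_def)
qed

lemma partial_cong: "(\<And>i. m \<le> i \<Longrightarrow> digit d i = digit e i) \<Longrightarrow> partial d m = partial e m"
  unfolding partial_def by (rule sum.cong) auto

lemma partial_antimono: "m \<le> m' \<Longrightarrow> partial d m' \<le> partial d m"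
  unfolding partial_def
  by (rule sum_mono2[OF finite_digits]) (auto simp: digit_nonneg)

lemma partial_nonneg: "0 \<le> partial d m"
  unfolding partial_def by (rule sum_nonneg) (auto simp: digit_nonneg)

lemma powi_Suc: "10 powi (m + 1) = 10 * (10 :: real) powi m"
  by (simp add: power_int_add)

lemma powi_neg_nat: "10 powi (- int n) = (1 / 10 :: real) ^ n"
  by (simp add: power_int_minus power_divide inverse_eq_divide)

text \<open>One step to the right adds at most 9 units of the new place, and one unit more completes
  a unit of the old place. So the intervals from \<open>partial d m\<close> to
  \<open>partial d m + 10 powi m\<close> are nested.\<close>

lemma partial_upper_mono: "m \<le> m' \<Longrightarrow> partial d m + 10 powi m \<le> partial d m' + 10 powi m'"
proof (induction m rule: int_le_induct)
  case (step i)
  have "(of_int (digit d (i - 1)) :: real) + 1 \<le> 10"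
    using digit_le_9[of d "i - 1"] by linarith
  then have "(of_int (digit d (i - 1)) + 1) * 10 powi (i - 1) \<le> 10 * (10 :: real) powi (i - 1)"
    by (intro mult_right_mono) auto
  then have "partial d (i - 1) + 10 powi (i - 1) \<le> partial d i + 10 powi i"
    using partial_step[of d "i - 1"] powi_Suc[of "i - 1"] by (simp add: algebra_simps)
  then show ?case using step by linarith
qed simp

lemma partial_le_upper: "partial d m' \<le> partial d m + 10 powi m"
proof (cases "m' \<le> m")
  case True
  have "0 \<le> (10::real) powi m'" by simp
  then show ?thesis using partial_upper_mono[OF True, of d] by linarith
next
  case False
  have "0 \<le> (10::real) powi m" by simp
  moreover have "partial d m' \<le> partial d m" using False by (intro partial_antimono) simp
  ultimately show ?thesis by linarith
qed

section \<open>Magnitude as supremum of the partial sums\<close>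

definition mag :: "decimal \<Rightarrow> real" where
  "mag d = (SUP m. partial d m)"

lemma partial_le_mag: "partial d m \<le> mag d"
  unfolding mag_def
  by (intro cSUP_upper bdd_aboveI2[where M = "partial d 0 + 10 powi 0"] partial_le_upper) simp

lemma mag_le_upper: "mag d \<le> partial d m + 10 powi m"
  unfolding mag_def using partial_le_upper by (intro cSUP_least) auto

lemma mag_eqI:
  assumes "\<And>n. \<bar>partial d (- int n) - x\<bar> \<le> 10 powi (- int n)"
  shows "mag d = x"
proof (rule ccontr)
  assume "mag d \<noteq> x"
  then obtain n where n: "(1 / 10 :: real) ^ n < \<bar>mag d - x\<bar> / 2"
    using real_arch_pow_inv[of "\<bar>mag d - x\<bar> / 2" "1 / 10"] by auto
  define q where "q = (10::real) powi (- int n)"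
  have "\<bar>mag d - partial d (- int n)\<bar> \<le> q"
    using mag_le_upper[of d "- int n"] partial_le_mag[of d "- int n"] by (simp add: q_def)
  moreover have "\<bar>partial d (- int n) - x\<bar> \<le> q" using assms[of n] by (simp add: q_def)
  moreover have "q < \<bar>mag d - x\<bar> / 2" using n powi_neg_nat[of n] by (simp add: q_def)
  ultimately show False by (simp add: abs_le_iff) linarith
qed

lemma mag_eq_partialI:
  assumes "\<And>i. i < m \<Longrightarrow> digit d i = 0"
  shows "mag d = partial d m"
proof -
  have "partial d i \<le> partial d m" for i
  proof (cases "i \<le> m")
    case True
    then have "partial d i = partial d m" using assms
      unfolding partial_def by (intro sum.cong) (auto, meson leI)
    then show ?thesis by simp
  qed (simp add: partial_antimono)
  then have "mag d \<le> partial d m" unfolding mag_def by (intro cSUP_least) auto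
  then show ?thesis using partial_le_mag[of d m] by simp
qed

text \<open>A nonzero digit right of place \<open>m\<close> would lift a later partial sum above
  \<open>mag d\<close>.\<close>

lemma mag_eq_partialD:
  assumes "mag d = partial d m" "i < m"
  shows "digit d i = 0"
proof (rule ccontr)
  assume "digit d i \<noteq> 0"
  then have "0 < of_int (digit d i) * (10::real) powi i"
    using digit_nonneg[of d i] by simp
  moreover have "partial d m \<le> partial d (i + 1)" using assms by (intro partial_antimono) simp
  ultimately show False using partial_step[of d i] partial_le_mag[of d i] assms by linarith
qed

text \<open>A digit below 9 at place \<open>i\<close> makes the upper endpoint drop strictly there.
  Endpoints never rise to the right, so \<open>mag d\<close> would lie strictly below the endpoint
  at \<open>m\<close>.\<close>

lemma mag_eq_upperD:
  assumes "mag d = partial d m + 10 powi m" "i < m"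
  shows "digit d i = 9"
proof (rule ccontr)
  assume "digit d i \<noteq> 9"
  then have "of_int (digit d i) + 1 < (10::real)" using digit_le_9[of d i] by simp
  then have "(of_int (digit d i) + 1) * 10 powi i < 10 * (10::real) powi i"
    by (intro mult_strict_right_mono) auto
  then have "partial d i + 10 powi i < partial d (i + 1) + 10 powi (i + 1)"
    using partial_step[of d i] powi_Suc[of i] by (simp add: algebra_simps)
  also have "\<dots> \<le> mag d" using partial_upper_mono[of "i + 1" m d] assms by simp
  finally show False using mag_le_upper[of d i] by simp
qed

lemma mag_nonneg: "0 \<le> mag d"
  using partial_nonneg[of d 0] partial_le_mag[of d 0] by linarith

lemma mag_eq_0_iff: "mag d = 0 \<longleftrightarrow> d = dzero"
proof
  assume 0: "mag d = 0"
  have "digit d i = 0" for i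
  proof (rule mag_eq_partialD)
    show "mag d = partial d (i + 1)"
      using 0 partial_nonneg[of d "i + 1"] partial_le_mag[of d "i + 1"] by simp
  qed simp
  then show "d = dzero" by (simp add: eq_dzero_iff)
next
  assume "d = dzero"
  then show "mag d = 0" by (simp add: mag_eq_partialI[of 0] partial_def)
qed

section \<open>Magnitudes compared at the first differing digit\<close>

lemma partial_lex:
  assumes "\<forall>i>m. digit d i = digit e i" "digit d m < digit e m"
  shows "partial d m + 10 powi m \<le> partial e m"
proof -
  have "partial d (m + 1) = partial e (m + 1)" using assms by (intro partial_cong) auto
  moreover have "of_int (digit d m) + 1 \<le> (of_int (digit e m) :: real)" using assms by linarith
  then have "(of_int (digit d m) + 1) * 10 powi m \<le> of_int (digit e m) * (10::real) powi m"
    by (intro mult_right_mono) auto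
  ultimately show ?thesis using partial_step[of d m] partial_step[of e m]
    by (simp add: algebra_simps)
qed

text \<open>The chain \<open>mag d\<close> \<le> \<open>partial d m + 10 powi m\<close> \<le>
  \<open>partial e m\<close> \<le> \<open>mag e\<close> gives the inequality. If its ends agree, all
  terms agree, and the extreme cases above force a tail of nines and a tail of zeros.\<close>

lemma mag_lex:
  assumes "\<forall>i>m. digit d i = digit e i" "digit d m < digit e m"
  shows "mag d \<le> mag e" and "mag d = mag e \<Longrightarrow> i < m \<Longrightarrow> digit d i = 9 \<and> digit e i = 0"
proof -
  note * = partial_lex[OF assms] mag_le_upper[of d m] partial_le_mag[of e m]
  show "mag d \<le> mag e" using * by linarith
  assume "mag d = mag e" "i < m"
  moreover from this have "mag d = partial d m + 10 powi m" "mag e = partial e m"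
    using * by linarith+
  ultimately show "digit d i = 9 \<and> digit e i = 0"
    using mag_eq_upperD mag_eq_partialD by blast
qed

section \<open>Magnitude under shifts and truncations\<close>

lemma mag_shift: "mag (shift k d) = 10 powi k * mag d"
proof -
  have *: "partial (shift k d) m = 10 powi k * partial d (m - k)" for m
    unfolding partial_def sum_distrib_left
    by (rule sum.reindex_bij_witness[of _ "\<lambda>i. i + k" "\<lambda>i. i - k"])
       (auto simp: digit_shift power_int_diff)
  show ?thesis
  proof (rule antisym)
    have "partial (shift k d) m \<le> 10 powi k * mag d" for m
      unfolding * by (intro mult_left_mono partial_le_mag) simp
    then show "mag (shift k d) \<le> 10 powi k * mag d"
      unfolding mag_def[of "shift k d"] by (intro cSUP_least) auto
    have "partial d m \<le> mag (shift k d) / 10 powi k" for m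
      using partial_le_mag[of "shift k d" "m + k"] by (simp add: * field_simps)
    then have "mag d \<le> mag (shift k d) / 10 powi k"
      unfolding mag_def[of d] by (intro cSUP_least) auto
    then show "10 powi k * mag d \<le> mag (shift k d)" by (simp add: field_simps)
  qed
qed

lemma mag_trunc: "mag (trunc d n) = partial d (- int n)"
  by (subst mag_eq_partialI[of "- int n"]) (auto simp: digit_trunc intro!: partial_cong)

lemma trunc_eq_dzeroI: "mag d < 10 powi (- int n) \<Longrightarrow> trunc d n = dzero"
proof -
  assume less: "mag d < 10 powi (- int n)"
  have "digit d i = 0" if "i \<ge> - int n" for i
  proof (rule ccontr)
    assume "digit d i \<noteq> 0"
    then have "1 \<le> (of_int (digit d i) :: real)" using digit_nonneg[of d i] by simp
    then have "1 * 10 powi i \<le> of_int (digit d i) * (10::real) powi i"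
      by (intro mult_right_mono) auto
    then have "10 powi i \<le> mag d"
      using partial_step[of d i] partial_nonneg[of d "i + 1"] partial_le_mag[of d i] by linarith
    moreover have "10 powi (- int n) \<le> (10::real) powi i"
      using that by (intro power_int_increasing) auto
    ultimately show False using less by linarith
  qed
  then show ?thesis by (simp add: eq_dzero_iff digit_trunc)
qed

text \<open>The bound cannot be strict: 0.0999... truncates to zero at \<open>n = 1\<close> but has
  magnitude 1/10.\<close>

lemma trunc_eq_dzeroD: "trunc d n = dzero \<Longrightarrow> mag d \<le> 10 powi (- int n)"
  using mag_le_upper[of d "- int n"] mag_trunc[of d n] mag_eq_0_iff[of "trunc d n"] by simp

section \<open>Expansion of a nonnegative real number\<close>

lemma floor_div_10: "\<lfloor>(x::real) / 10 powi m\<rfloor> =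
  10 * \<lfloor>x / 10 powi (m + 1)\<rfloor> + \<lfloor>x / 10 powi m\<rfloor> mod 10"
proof -
  have "\<lfloor>x / 10 powi (m + 1)\<rfloor> = \<lfloor>(x / 10 powi m) / of_int 10\<rfloor>"
    by (simp add: powi_Suc mult.commute)
  also have "\<dots> = \<lfloor>x / 10 powi m\<rfloor> div 10"
    by (rule floor_divide_real_eq_div) simp
  finally show ?thesis by simp
qed

text \<open>The digit at place \<open>i\<close> is the last digit of the floor of
  \<open>x / 10 powi i\<close>. The partial sums are then \<open>x\<close> rounded down to multiples
  of \<open>10 powi m\<close>. The digit formula stays in the conclusion because
  \<open>ex_Z0_val\<close> reads off from it that integers have no fractional digits.\<close>

lemma ex_mag:
  assumes "0 \<le> x"
  shows "\<exists>d. mag d = x \<and> dsign d \<noteq> Some Minus \<and> (\<forall>i. digit d i = \<lfloor>x / 10 powi i\<rfloor> mod 10)"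
proof -
  define a where "a i = \<lfloor>x / 10 powi i\<rfloor> mod 10" for i
  \<comment> \<open>All digits from place \<open>K\<close> on vanish, which bounds the string on the
    left and starts the downward induction.\<close>
  obtain K where "x < 10 ^ K" using real_arch_pow[of 10 x] by auto
  have floor0: "\<lfloor>x / 10 powi i\<rfloor> = 0" if "i \<ge> int K" for i
  proof -
    have "10 powi int K \<le> (10::real) powi i" using that by (intro power_int_increasing) auto
    then have "x < 10 powi i" using \<open>x < 10 ^ K\<close> by simp
    then show ?thesis using assms by (simp add: floor_eq_iff)
  qed
  have "0 \<le> a i" "a i \<le> 9" for i
    using pos_mod_bound[of 10 "\<lfloor>x / 10 powi i\<rfloor>"] by (auto simp: a_def)
  moreover have "\<forall>i>int K. a i = 0" using floor0 by (simp add: a_def)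
  ultimately have
    "\<exists>d. dsign d = (if \<forall>i. a i = 0 then None else Some Plus) \<and> digit d = a"
    by (intro ex_decimal) auto
  then obtain d where d: "dsign d = (if \<forall>i. a i = 0 then None else Some Plus)" "digit d = a"
    by blast
  have partial: "partial d m = of_int \<lfloor>x / 10 powi m\<rfloor> * 10 powi m" if "m \<le> int K" for m
    using that
  proof (induction m rule: int_le_induct)
    case base
    have "{i. int K \<le> i \<and> digit d i \<noteq> 0} = {}" using floor0 by (auto simp: d a_def)
    moreover have "\<lfloor>x / 10 powi int K\<rfloor> = 0" using floor0 by blast
    ultimately show ?case by (simp add: partial_def)
  next
    case (step i)
    have *: "\<lfloor>x / 10 powi (i - 1)\<rfloor> = 10 * \<lfloor>x / 10 powi i\<rfloor> + a (i - 1)"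
      using floor_div_10[of x "i - 1"] by (simp add: a_def)
    show ?case
      using partial_step[of d "i - 1"] step.IH powi_Suc[of "i - 1"]
      by (subst *) (simp add: d algebra_simps)
  qed
  have "mag d = x"
  proof (rule mag_eqI)
    fix n
    let ?p = "(10::real) powi (- int n)"
    have p: "0 < ?p" by simp
    have 1: "of_int \<lfloor>x / ?p\<rfloor> * ?p \<le> x"
      using mult_right_mono[OF of_int_floor_le[of "x / ?p"], of ?p] p by simp
    have 2: "x \<le> (of_int \<lfloor>x / ?p\<rfloor> + 1) * ?p"
      using mult_right_mono[OF less_imp_le[OF floor_correct[of "x / ?p", THEN conjunct2]], of ?p] p
      by simp
    show "\<bar>partial d (- int n) - x\<bar> \<le> ?p"
      using 1 2 by (subst partial) (auto simp: algebra_simps abs_if)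
  qed
  then show ?thesis using d by (intro exI[of _ d]) (auto simp: a_def)
qed

section \<open>The value of a decimal\<close>

definition sgnum :: "decimal \<Rightarrow> real" where
  "sgnum d = (case dsign d of None \<Rightarrow> 0 | Some Plus \<Rightarrow> 1 | Some Minus \<Rightarrow> - 1)"

definition val :: "decimal \<Rightarrow> real" where
  "val d = sgnum d * mag d"

text \<open>Couples the sign with value and magnitude, so that simplification discards impossible
  sign combinations.\<close>

lemma dsign_cases:
  obtains "d = dzero" "dsign d = None" "val d = 0" "mag d = 0"
  | "dsign d = Some Plus" "val d = mag d" "0 < mag d"
  | "dsign d = Some Minus" "val d = - mag d" "0 < mag d"
proof (cases "dsign d")
  case None
  then have "d = dzero" by (simp add: dsign_None_iff eq_dzero_iff)
  then show thesis using that(1) by (simp add: val_def sgnum_def mag_eq_0_iff)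
next
  case (Some s)
  then have "d \<noteq> dzero" by auto
  then have "0 < mag d" using mag_nonneg[of d] mag_eq_0_iff[of d] by linarith
  then show thesis using Some that(2,3) by (cases s) (auto simp: val_def sgnum_def)
qed

lemma abs_val: "\<bar>val d\<bar> = mag d"
  by (cases d rule: dsign_cases) auto

lemma val_dzero [simp]: "val dzero = 0"
  by (simp add: val_def sgnum_def)

lemma val_dminus: "val (dminus d) = - val d"
proof -
  have "mag (dminus d) = mag d" by (simp add: mag_def partial_def)
  then show ?thesis
    by (auto simp: val_def sgnum_def dsign_dminus split: option.splits sign.splits)
qed

lemma val_shift: "val (shift k d) = 10 powi k * val d"
  by (simp add: val_def sgnum_def mag_shift)

lemma val_trunc: "val (trunc d n) = sgnum d * partial d (- int n)"
proof (cases "\<forall>i\<ge>- int n. digit d i = 0")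
  case True
  then have "trunc d n = dzero" by (auto simp: eq_dzero_iff digit_trunc)
  then show ?thesis using mag_trunc[of d n] mag_eq_0_iff[of dzero] by simp
next
  case False
  then have "dsign (trunc d n) = dsign d" by (auto simp: dsign_trunc)
  then show ?thesis by (simp add: val_def sgnum_def mag_trunc)
qed

lemma val_dunit [simp]: "val dunit = 1"
proof -
  have "mag dunit = partial dunit 0" by (rule mag_eq_partialI) (simp add: digit_dunit)
  also have "\<dots> = 1"
  proof -
    have "{i::int. 0 \<le> i \<and> digit dunit i \<noteq> 0} = {0}" by (auto simp: digit_dunit)
    then show ?thesis by (simp add: partial_def digit_dunit)
  qed
  finally show ?thesis by (simp add: val_def sgnum_def)
qed

lemma surj_val: "\<exists>d. val d = x"
proof -
  obtain d where d: "mag d = \<bar>x\<bar>" "dsign d \<noteq> Some Minus" using ex_mag[of "\<bar>x\<bar>"] by auto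
  then have "val d = \<bar>x\<bar>" by (cases d rule: dsign_cases) auto
  then show ?thesis using val_dminus[of d] by (metis abs_if minus_minus)
qed

lemma ex_Z0_val: "\<exists>d\<in>Z0. val d = of_int n"
proof -
  obtain d where d: "mag d = \<bar>of_int n\<bar>" "dsign d \<noteq> Some Minus"
    and digit: "\<And>i. digit d i = \<lfloor>\<bar>of_int n\<bar> / (10::real) powi i\<rfloor> mod 10"
    using ex_mag[of "\<bar>of_int n\<bar>"] by auto
  have "digit d i = 0" if "i < 0" for i
  proof -
    \<comment> \<open>With \<open>i = - int (Suc k)\<close>, dividing by \<open>10 powi i\<close>
      multiplies the integer by at least one factor 10, so its last digit is 0.\<close>
    define k where "k = nat (- i - 1)"
    have i: "i = - int (Suc k)" using that by (simp add: k_def)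
    have "\<bar>of_int n\<bar> / (10::real) powi i = of_int (\<bar>n\<bar> * 10 ^ Suc k)"
      unfolding i powi_neg_nat by (simp add: power_divide)
    then have "\<lfloor>\<bar>of_int n\<bar> / (10::real) powi i\<rfloor> = \<bar>n\<bar> * 10 ^ Suc k"
      by (metis floor_of_int)
    then show ?thesis by (simp add: digit)
  qed
  then have Z0: "d \<in> Z0" by (simp add: Z0_def)
  then have "dminus d \<in> Z0" by (simp add: Z0_def)
  moreover have "val d = of_int \<bar>n\<bar>" using d by (cases d rule: dsign_cases) auto
  ultimately show ?thesis using Z0 val_dminus[of d]
    by (metis abs_if minus_minus of_int_minus)
qed

text \<open>Turns the arithmetic transferred by \<open>decadic\<close> into arithmetic of
  values.\<close>

lemma val_Z0: "d \<in> Z0 \<Longrightarrow> val d = of_int (decadic d)"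
proof -
  assume "d \<in> Z0"
  then have "mag d = partial d 0" by (intro mag_eq_partialI) (simp add: Z0_def)
  also have "\<dots> = of_int (\<Sum>i | 0 \<le> i \<and> digit d i \<noteq> 0. digit d i * 10 ^ nat i)"
    unfolding partial_def of_int_sum
    by (rule sum.cong) (auto simp: power_int_def)
  finally show ?thesis
    by (simp add: val_def sgnum_def decadic_def split: option.splits sign.splits)
qed

section \<open>Order of decimals and jumps\<close>

lemma dless_linear: "d \<noteq> e \<Longrightarrow> dless d e \<or> dless e d"
proof -
  assume neq: "d \<noteq> e"
  have lex: "\<exists>m. (\<forall>i>m. digit d i = digit e i) \<and> digit d m \<noteq> digit e m"
    if "dsign d = dsign e"
  proof -
    have "digit d \<noteq> digit e" using neq that decimal_eqI by blast
    then obtain j where j: "digit d j \<noteq> digit e j" by auto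
    \<comment> \<open>Both strings vanish far to the left, so this set is finite; its maximum is the
      leftmost differing place.\<close>
    let ?S = "{i. j \<le> i \<and> digit d i \<noteq> digit e i}"
    have "finite ?S"
      by (rule finite_subset[of _ "{i. j \<le> i \<and> digit d i \<noteq> 0} \<union> {i. j \<le> i \<and> digit e i \<noteq> 0}"])
         (auto simp: finite_digits)
    moreover have "j \<in> ?S" using j by simp
    ultimately obtain m where m: "m \<in> ?S" "\<forall>i\<in>?S. i \<le> m"
      using Max_in[of ?S] Max_ge[of ?S] by blast
    have "i \<le> m" if "digit d i \<noteq> digit e i" for i
      using that m by (cases "j \<le> i") auto
    then have "\<forall>i>m. digit d i = digit e i" by (meson not_le)
    then show ?thesis using m by blast
  qed
  show ?thesis
    using neq lex
    by (cases d rule: dsign_cases; cases e rule: dsign_cases)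
       (simp_all add: dless_def, (metis linorder_neqE)+)
qed

lemma dless_imp_val_le: "dless d e \<Longrightarrow> val d \<le> val e"
  by (cases d rule: dsign_cases; cases e rule: dsign_cases)
     (auto simp: dless_def
        intro: mag_lex(1)[of _ d e] mag_lex(1)[of _ e d, OF allI[OF impI[OF sym]]])

lemma val_less_imp_dless: "val d < val e \<Longrightarrow> dless d e"
  using dless_linear[of d e] dless_imp_val_le[of e d] by force

text \<open>Equal values exclude mixed signs. The rest is the equality case of
  \<open>mag_lex\<close>, with the roles of \<open>d\<close> and \<open>e\<close> exchanged for
  negative decimals.\<close>

lemma dless_val_eqD:
  assumes "dless d e" "val d = val e"
  shows "\<exists>m. dsign d = Some Plus \<and> dsign e = Some Plus \<and> (\<forall>i<m. digit d i = 9 \<and> digit e i = 0) \<or>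
    dsign d = Some Minus \<and> dsign e = Some Minus \<and> (\<forall>i<m. digit d i = 0 \<and> digit e i = 9)"
proof (cases d rule: dsign_cases)
  case 1
  with assms show ?thesis by (cases e rule: dsign_cases) (auto simp: dless_def)
next
  case 2
  with assms have e: "dsign e = Some Plus" "mag d = mag e"
    by (cases e rule: dsign_cases; simp)+
  then obtain m where "\<forall>i>m. digit d i = digit e i" "digit d m < digit e m"
    using assms 2 by (auto simp: dless_def)
  then have "\<forall>i<m. digit d i = 9 \<and> digit e i = 0" using mag_lex(2) e by blast
  then show ?thesis using 2 e by blast
next
  case 3
  with assms have e: "dsign e = Some Minus" "mag e = mag d"
    by (cases e rule: dsign_cases; simp)+
  then obtain m where m: "\<forall>i>m. digit d i = digit e i" "digit e m < digit d m"
    using assms 3 by (auto simp: dless_def)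
  have "\<forall>i>m. digit e i = digit d i" using m by metis
  then have "\<forall>i<m. digit e i = 9 \<and> digit d i = 0" using mag_lex(2) m e by blast
  then show ?thesis using 3 e by blast
qed

text \<open>A decimal strictly between two others of the same value would end both in nines and in zeros.\<close>

lemma jump_iff: "jump d e \<longleftrightarrow> dless d e \<and> val d = val e"
proof
  assume "jump d e"
  then have d: "dless d e" and no: "\<And>f. \<not> (dless d f \<and> dless f e)" by (auto simp: jump_def)
  \<comment> \<open>A decimal whose value lies strictly between the two would fill the jump.\<close>
  have "\<not> val d < val e"
    using no surj_val dense[of "val d" "val e"] val_less_imp_dless by metis
  then show "dless d e \<and> val d = val e" using d dless_imp_val_le[OF d] by simp
next
  assume de: "dless d e \<and> val d = val e"
  have False if f: "dless d f" "dless f e" for f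
  proof -
    have v: "val d = val f" "val f = val e" using f[THEN dless_imp_val_le] de by auto
    obtain m m' where
      "\<forall>i<m. dsign f = Some Plus \<and> digit f i = 0 \<or> dsign f = Some Minus \<and> digit f i = 9"
      "\<forall>i<m'. dsign f = Some Plus \<and> digit f i = 9 \<or> dsign f = Some Minus \<and> digit f i = 0"
      using dless_val_eqD[OF f(1) v(1)] dless_val_eqD[OF f(2) v(2)] by blast
    \<comment> \<open>At this place both tail conditions apply, and they demand that one digit be
      both 0 and 9.\<close>
    moreover have "min m m' - 1 < m" "min m m' - 1 < m'" by auto
    ultimately show False by fastforce
  qed
  then show "jump d e" using de by (auto simp: jump_def)
qed

text \<open>Distinct decimals are comparable, so equal values make them a jump in one
  direction.\<close>

lemma deq_iff: "(d, e) \<in> deq \<longleftrightarrow> val d = val e"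
  using dless_linear[of d e] by (auto simp: deq_def jump_iff)

section \<open>Terminating decimals\<close>

lemma T0_iff: "d \<in> T0 \<longleftrightarrow> (\<exists>m. \<forall>i<m. digit d i = 0)"
proof
  assume "d \<in> T0"
  then have "bdd_below {i. digit d i \<noteq> 0}" by (simp add: T0_def)
  then obtain m where "\<forall>i\<in>{i. digit d i \<noteq> 0}. m \<le> i" unfolding bdd_below_def by blast
  then have "\<forall>i<m. digit d i = 0" by force
  then show "\<exists>m. \<forall>i<m. digit d i = 0" ..
next
  assume "\<exists>m. \<forall>i<m. digit d i = 0"
  then obtain m where "\<forall>i<m. digit d i = 0" ..
  then have "{i. digit d i \<noteq> 0} \<subseteq> {i. m \<le> i \<and> digit d i \<noteq> 0}" by (auto simp: not_less[symmetric])
  then show "d \<in> T0" unfolding T0_def using finite_digits finite_subset by blast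
qed

lemma T0_dminus: "d \<in> T0 \<Longrightarrow> dminus d \<in> T0"
  by (simp add: T0_def)

lemma T0_trunc: "trunc d n \<in> T0"
  by (auto simp: T0_iff digit_trunc intro!: exI[of _ "- int n"])

lemma shift_Z0_in_T0: "d \<in> Z0 \<Longrightarrow> shift k d \<in> T0"
  by (auto simp: T0_iff Z0_def digit_shift intro!: exI[of _ k])

text \<open>A threshold rather than one exponent, so that two decimals can be shifted by a common
  exponent.\<close>

lemma shift_T0_in_Z0: "d \<in> T0 \<Longrightarrow> \<exists>k. \<forall>j\<ge>k. shift j d \<in> Z0"
proof -
  assume "d \<in> T0"
  then obtain m where "\<forall>i<m. digit d i = 0" by (auto simp: T0_iff)
  then show ?thesis by (intro exI[of _ "- m"]) (auto simp: Z0_def digit_shift)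
qed

text \<open>Of two distinct decimals with equal value one ends in nines, so it does not
  terminate.\<close>

lemma inj_val_T0: "inj_on val T0"
proof -
  have "\<not> dless d e" if T0: "d \<in> T0" "e \<in> T0" and eq: "val d = val e" for d e
  proof
    assume "dless d e"
    obtain m1 m2 where m12: "\<forall>i<m1. digit d i = 0" "\<forall>i<m2. digit e i = 0"
      using T0 by (auto simp: T0_iff)
    obtain m3 where m3: "\<forall>i<m3. digit d i = 9 \<or> digit e i = 9"
      using dless_val_eqD[OF \<open>dless d e\<close> eq] by blast
    define i where "i = min m1 (min m2 m3) - 1"
    have "i < m1" "i < m2" "i < m3" by (auto simp: i_def)
    then show False using m12 m3 by force
  qed
  then show ?thesis using dless_linear by (metis inj_onI)
qed

section \<open>Transferred arithmetic on terminating decimals\<close>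

lemma Z0_inverse: "the_inv_into Z0 decadic n \<in> Z0"
  "val (the_inv_into Z0 decadic n) = of_int n"
proof -
  have "Z0 \<subseteq> T0" by (auto simp: Z0_def T0_iff intro!: exI[of _ 0])
  then have inj: "inj_on decadic Z0"
    using inj_val_T0 val_Z0 by (metis inj_on_def subsetD)
  obtain d where "d \<in> Z0" "val d = of_int n" using ex_Z0_val by blast
  moreover from this have "decadic d = n" using val_Z0 by simp
  ultimately show "the_inv_into Z0 decadic n \<in> Z0" "val (the_inv_into Z0 decadic n) = of_int n"
    using the_inv_into_f_f[OF inj] by metis+
qed

text \<open>All candidates \<open>f k\<close> terminate and share a value, so they coincide by
  \<open>inj_val_T0\<close>. An admissible exponent must exist, since otherwise every decimal would
  satisfy the description vacuously.\<close>

lemma T0_operation: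
  fixes P :: "int \<Rightarrow> bool"
  assumes "\<exists>k. P k" "\<And>k. P k \<Longrightarrow> f k \<in> T0 \<and> val (f k) = x"
  shows "(THE e. \<forall>k. P k \<longrightarrow> e = f k) \<in> T0 \<and> val (THE e. \<forall>k. P k \<longrightarrow> e = f k) = x"
proof -
  obtain k where k: "P k" using assms(1) ..
  have "(THE e. \<forall>k. P k \<longrightarrow> e = f k) = f k"
  proof (rule the_equality)
    show "\<forall>j. P j \<longrightarrow> f k = f j" using assms(2) k inj_val_T0 by (metis inj_onD)
  qed (use k in blast)
  then show ?thesis using assms(2)[OF k] by simp
qed

lemma ex_common_shift:
  assumes "c \<in> T0" "d \<in> T0"
  shows "\<exists>k. shift k c \<in> Z0 \<and> shift k d \<in> Z0"
proof -
  obtain k j where "\<forall>i\<ge>k. shift i c \<in> Z0" "\<forall>i\<ge>j. shift i d \<in> Z0"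
    using assms shift_T0_in_Z0 by blast
  then show ?thesis by (intro exI[of _ "max k j"]) simp
qed

lemma dadd_T0:
  assumes "c \<in> T0" "d \<in> T0"
  shows "dadd c d \<in> T0" "val (dadd c d) = val c + val d"
proof -
  have "dadd c d \<in> T0 \<and> val (dadd c d) = val c + val d"
    unfolding dadd_def
  proof (rule T0_operation[OF ex_common_shift[OF assms]])
    fix k assume k: "shift k c \<in> Z0 \<and> shift k d \<in> Z0"
    then have "val (Z0_add (shift k c) (shift k d)) = 10 powi k * (val c + val d)"
      by (simp add: Z0_add_def Z0_inverse val_shift distrib_left flip: val_Z0)
    then show "shift (- k) (Z0_add (shift k c) (shift k d)) \<in> T0 \<and>
      val (shift (- k) (Z0_add (shift k c) (shift k d))) = val c + val d"
      by (simp add: val_shift power_int_minus Z0_add_def Z0_inverse shift_Z0_in_T0)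
  qed
  then show "dadd c d \<in> T0" "val (dadd c d) = val c + val d" by auto
qed

lemma dmult_T0:
  assumes "c \<in> T0" "d \<in> T0"
  shows "dmult c d \<in> T0" "val (dmult c d) = val c * val d"
proof -
  have "dmult c d \<in> T0 \<and> val (dmult c d) = val c * val d"
    unfolding dmult_def
  proof (rule T0_operation[OF ex_common_shift[OF assms]])
    fix k assume k: "shift k c \<in> Z0 \<and> shift k d \<in> Z0"
    then have "val (Z0_mult (shift k c) (shift k d)) = (10 powi k * val c) * (10 powi k * val d)"
      by (simp add: Z0_mult_def Z0_inverse flip: val_Z0 val_shift)
    \<comment> \<open>Each factor was scaled once, so the product carries the scale twice.\<close>
    moreover have "(10::real) powi (- 2 * k) = inverse (10 powi k * 10 powi k)"
      by (simp flip: power_int_add power_int_minus)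
    moreover have "(10::real) powi k \<noteq> 0" by simp
    ultimately show "shift (- 2 * k) (Z0_mult (shift k c) (shift k d)) \<in> T0 \<and>
      val (shift (- 2 * k) (Z0_mult (shift k c) (shift k d))) = val c * val d"
      by (simp add: val_shift Z0_mult_def Z0_inverse shift_Z0_in_T0 field_simps)
  qed
  then show "dmult c d \<in> T0" "val (dmult c d) = val c * val d" by auto
qed

section \<open>Hybrid limits are limits of values\<close>

text \<open>A truncation at \<open>k\<close> vanishes if the absolute value is below
  \<open>10 powi (- int k)\<close>, and only if it is at most that.\<close>

lemma tends_to_zero_iff: "tends_to_zero c \<longleftrightarrow> (\<lambda>n. val (c n)) \<longlonglongrightarrow> 0"
proof
  assume c: "tends_to_zero c"
  show "(\<lambda>n. val (c n)) \<longlonglongrightarrow> 0"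
  proof (rule LIMSEQ_I)
    fix r :: real assume "0 < r"
    then obtain k where k: "(1 / 10 :: real) ^ k < r" using real_arch_pow_inv[of r "1 / 10"] by auto
    \<comment> \<open>\<open>tends_to_zero\<close> speaks only of precisions from 1 on, hence
      \<open>Suc k\<close> in place of \<open>k\<close>.\<close>
    have "(1 / 10 :: real) ^ Suc k \<le> (1 / 10) ^ k" by (intro power_decreasing) auto
    then have k': "(1 / 10 :: real) ^ Suc k < r" using k by linarith
    obtain N where "\<forall>n>N. trunc (c n) (Suc k) = dzero"
      using c unfolding tends_to_zero_def by (metis Suc_eq_plus1_left le_add1)
    then have "\<forall>n\<ge>Suc N. norm (val (c n) - 0) < r"
      using trunc_eq_dzeroD powi_neg_nat k' abs_val
      by (metis Suc_le_eq diff_zero order_le_less_trans real_norm_def)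
    then show "\<exists>N. \<forall>n\<ge>N. norm (val (c n) - 0) < r" ..
  qed
next
  assume c: "(\<lambda>n. val (c n)) \<longlonglongrightarrow> 0"
  show "tends_to_zero c"
    unfolding tends_to_zero_def
  proof (intro allI impI)
    fix k
    obtain N where "\<forall>n\<ge>N. norm (val (c n) - 0) < 10 powi (- int k)"
      using LIMSEQ_D[OF c, of "10 powi (- int k)"] by auto
    then have "\<forall>n>max N 1. trunc (c n) k = dzero"
      by (auto intro!: trunc_eq_dzeroI simp: abs_val)
    then show "\<exists>N\<ge>1. \<forall>n>N. trunc (c n) k = dzero" by (intro exI[of _ "max N 1"]) simp
  qed
qed

lemma val_trunc_LIMSEQ: "(\<lambda>n. val (trunc d n)) \<longlonglongrightarrow> val d"
proof -
  have "(\<lambda>n. partial d (- int n)) \<longlonglongrightarrow> mag d"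
  proof (rule tendsto_sandwich)
    show "(\<lambda>n. mag d - (1 / 10) ^ n) \<longlonglongrightarrow> mag d"
      using tendsto_diff[OF tendsto_const LIMSEQ_realpow_zero[of "1 / 10 :: real"]] by simp
    show "\<forall>\<^sub>F n in sequentially. mag d - (1 / 10) ^ n \<le> partial d (- int n)"
      using mag_le_upper[of d] by (intro always_eventually) (metis powi_neg_nat diff_le_eq)
  qed (auto simp: partial_le_mag)
  then show ?thesis unfolding val_trunc val_def[of d] by (intro tendsto_mult tendsto_const)
qed

text \<open>The differences from the truncations of \<open>d\<close> have values tending to
  \<open>x - val d\<close>, so they tend to zero exactly when \<open>val d = x\<close>.\<close>

lemma hlim_eq:
  assumes T0: "\<And>n. c n \<in> T0" and lim: "(\<lambda>n. val (c n)) \<longlonglongrightarrow> x"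
  shows "hlim c = {d. val d = x}"
proof -
  have "tends_to_zero (\<lambda>n. ddiff (c n) (trunc d n)) \<longleftrightarrow> val d = x" for d
  proof -
    have "(\<lambda>n. val (ddiff (c n) (trunc d n))) = (\<lambda>n. val (c n) - val (trunc d n))"
      by (simp add: ddiff_def dadd_T0 T0 T0_dminus T0_trunc val_dminus)
    moreover have "(\<lambda>n. val (c n) - val (trunc d n)) \<longlonglongrightarrow> x - val d"
      by (intro tendsto_diff lim val_trunc_LIMSEQ)
    ultimately show ?thesis
      unfolding tends_to_zero_iff by (metis LIMSEQ_unique eq_iff_diff_eq_0)
  qed
  then show ?thesis by (simp add: hlim_def)
qed

section \<open>The isomorphism\<close>

definition val_class :: "real \<Rightarrow> decimal set" where
  "val_class x = {d. val d = x}"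

lemma dclass_eq: "dclass d = val_class (val d)"
  by (auto simp: dclass_def val_class_def deq_iff)

lemma Reals_dec_eq: "Reals_dec = range val_class"
proof -
  have "Reals_dec = range dclass" by (auto simp: Reals_dec_def quotient_def dclass_def)
  also have "\<dots> = val_class ` range val" by (simp add: dclass_eq image_image)
  also have "range val = UNIV" using surj_val by (metis surj_def)
  finally show ?thesis .
qed

lemma inj_val_class: "val_class x = val_class y \<longleftrightarrow> x = y"
  using surj_val[of x] by (auto simp: val_class_def)

lemma rless_val_class: "rless (val_class x) (val_class y) \<longleftrightarrow> x < y"
proof
  assume "rless (val_class x) (val_class y)"
  then show "x < y" using dless_imp_val_le by (force simp: rless_def val_class_def)
next
  assume "x < y"
  moreover obtain d e where "val d = x" "val e = y" using surj_val by metis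
  ultimately show "rless (val_class x) (val_class y)"
    using val_less_imp_dless[of d e] inj_val_class[of x y]
    by (auto simp: rless_def) (auto simp: val_class_def)
qed

text \<open>Both classes are nonempty because \<open>val\<close> is surjective, so the described
  value is unique.\<close>

lemma val_class_operation:
  assumes "\<And>c d. val c = x \<Longrightarrow> val d = y \<Longrightarrow> f c d = \<delta>"
  shows "(THE \<gamma>. \<forall>c\<in>val_class x. \<forall>d\<in>val_class y. \<gamma> = f c d) = \<delta>"
proof (rule the_equality)
  show "\<forall>c\<in>val_class x. \<forall>d\<in>val_class y. \<delta> = f c d" using assms by (auto simp: val_class_def)
  show "\<gamma> = \<delta>" if "\<forall>c\<in>val_class x. \<forall>d\<in>val_class y. \<gamma> = f c d" for \<gamma>
    using that surj_val[of x] surj_val[of y] assms by (auto simp: val_class_def)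
qed

lemma radd_val_class: "radd (val_class x) (val_class y) = val_class (x + y)"
  unfolding radd_def
proof (rule val_class_operation)
  fix c d assume "val c = x" "val d = y"
  then show "hlim (\<lambda>n. dadd (trunc c n) (trunc d n)) = val_class (x + y)"
    unfolding val_class_def
    by (intro hlim_eq) (auto simp: dadd_T0 T0_trunc intro!: tendsto_add val_trunc_LIMSEQ)
qed

lemma rmult_val_class: "rmult (val_class x) (val_class y) = val_class (x * y)"
  unfolding rmult_def
proof (rule val_class_operation)
  fix c d assume "val c = x" "val d = y"
  then show "hlim (\<lambda>n. dmult (trunc c n) (trunc d n)) = val_class (x * y)"
    unfolding val_class_def
    by (intro hlim_eq) (auto simp: dmult_T0 T0_trunc intro!: tendsto_mult val_trunc_LIMSEQ)
qed

text \<open>With every carrier element written as \<open>val_class x\<close>, these rules reduce the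
  axioms to facts about real numbers.\<close>

lemma real_ring_simps:
  "carrier real_ring = range val_class"
  "\<zero>\<^bsub>real_ring\<^esub> = val_class 0"
  "\<one>\<^bsub>real_ring\<^esub> = val_class 1"
  "val_class x \<oplus>\<^bsub>real_ring\<^esub> val_class y = val_class (x + y)"
  "val_class x \<otimes>\<^bsub>real_ring\<^esub> val_class y = val_class (x * y)"
  by (simp_all add: real_ring_def Reals_dec_eq dclass_eq radd_val_class rmult_val_class)

section \<open>Field axioms, order and completeness\<close>

lemma field_real_ring: "field real_ring"
proof (rule cring.cring_fieldI2)
  show "cring real_ring"
  proof (rule cringI)
    show "abelian_group real_ring"
    proof (rule abelian_groupI)
      fix a assume "a \<in> carrier real_ring"
      then obtain x where "a = val_class x" by (auto simp: real_ring_simps)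
      then show "\<exists>b\<in>carrier real_ring. b \<oplus>\<^bsub>real_ring\<^esub> a = \<zero>\<^bsub>real_ring\<^esub>"
        by (intro bexI[of _ "val_class (- x)"]) (auto simp: real_ring_simps)
    qed (auto simp: real_ring_simps algebra_simps)
    show "comm_monoid real_ring"
      by (rule comm_monoidI) (auto simp: real_ring_simps algebra_simps)
  qed (auto simp: real_ring_simps algebra_simps)
  show "\<zero>\<^bsub>real_ring\<^esub> \<noteq> \<one>\<^bsub>real_ring\<^esub>" by (simp add: real_ring_simps inj_val_class)
  fix a assume "a \<in> carrier real_ring" "a \<noteq> \<zero>\<^bsub>real_ring\<^esub>"
  then obtain x where "a = val_class x" "x \<noteq> 0" by (auto simp: real_ring_simps)
  then show "\<exists>b\<in>carrier real_ring. a \<otimes>\<^bsub>real_ring\<^esub> b = \<one>\<^bsub>real_ring\<^esub>"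
    by (intro bexI[of _ "val_class (inverse x)"]) (auto simp: real_ring_simps)
qed

lemma ordered_field_real_ring: "ordered_field real_ring rless"
  by (intro ordered_field.intro field_real_ring ordered_field_axioms.intro)
     (auto simp: real_ring_simps rless_val_class inj_val_class)

theorem theorem2p2: "complete_ordered_field real_ring rless"
proof -
  interpret ordered_field real_ring rless by (rule ordered_field_real_ring)
  show ?thesis
  proof (intro complete_ordered_field.intro ordered_field_real_ring
      complete_ordered_field_axioms.intro)
    fix A assume A: "A \<subseteq> carrier real_ring" "A \<noteq> {}" and ub: "\<exists>u. is_upper_bound A u"
    \<comment> \<open>The preimage of \<open>A\<close> among the real numbers; its supremum is
      carried back by \<open>val_class\<close>.\<close>
    define X where "X = {x. val_class x \<in> A}"
    have "A \<subseteq> range val_class" using A by (simp add: real_ring_simps)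
    then have A_eq: "A = val_class ` X" unfolding X_def by blast
    then have "X \<noteq> {}" using A by auto
    have ub_iff: "is_upper_bound A (val_class u) \<longleftrightarrow> (\<forall>x\<in>X. x \<le> u)" for u
      by (auto simp: is_upper_bound_def A_eq real_ring_simps rless_val_class inj_val_class
          order_le_less)
    \<comment> \<open>Upper bounds lie in the carrier by definition, so \<open>ub_iff\<close> covers
      all of them.\<close>
    have carrier: "is_upper_bound A u \<Longrightarrow> \<exists>y. u = val_class y" for u
      by (auto simp: is_upper_bound_def real_ring_simps)
    have "bdd_above X" using ub carrier ub_iff by (metis bdd_aboveI)
    have "is_least_upper_bound A (val_class (Sup X))"
      unfolding is_least_upper_bound_def
    proof (intro conjI allI impI)
      show "is_upper_bound A (val_class (Sup X))"
        using \<open>bdd_above X\<close> by (auto simp: ub_iff intro: cSup_upper)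
      fix u assume u: "is_upper_bound A u"
      then obtain y where y: "u = val_class y" using carrier by blast
      then have "Sup X \<le> y" using u \<open>X \<noteq> {}\<close> ub_iff by (auto intro: cSup_least)
      then show "rless (val_class (Sup X)) u \<or> val_class (Sup X) = u"
        by (auto simp: y rless_val_class order_le_less)
    qed
    then show "\<exists>s. is_least_upper_bound A s" ..
  qed
qed

end
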